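(* Let $n$ be a positive integer. Then there exists a finite multipermutation square-free non-degenerate involutive set-theoretic solution $(X,r)$ of the Yang-Baxter equation of multipermutation level $n$ such that its associated involutive Yang-Baxter group $\mathcal{G}(X,r)$ is an elementary abelian $2$-group.
   Context: Let $X$ be a non-empty set and $r\colon X^2\to X^2$ a map, written $r(x,y)=(\sigma_x(y),\gamma_y(x))$. The pair $(X,r)$ is a non-degenerate involutive set-theoretic solution of the Yang-Baxter equation if: $r^2=\mathrm{id}_{X^2}$; the maps $\sigma_x$ and $\gamma_x$ are bijections $X\to X$ for all $x\in X$; and $r_1r_2r_1=r_2r_1r_2$, where $r_1=r\times\mathrm{id}_X$ and $r_2=\mathrm{id}_X\times r$ as maps $X^3\to X^3$. It is finite if $X$ is finite, and square free if $r(x,x)=(x,x)$ for all $x\in X$. $\mathcal{G}(X,r)$ denotes the subgroup of the symmetric group $\mathrm{Sym}_X$ generated by $\{\sigma_x\mid x\in X\}$; when $X$ is finite it is called the involutive Yang-Baxter (IYB) group associated to $(X,r)$. Retraction: define $x\sim y$ on $X$ if $\sigma_x=\sigma_y$. There is a (well-defined) induced non-degenerate involutive set-theoretic solution $\mathrm{Ret}(X,r)=(X/\!\sim,\tilde r)$ with $\tilde r([x],[y])=([\sigma_x(y)],[\gamma_y(x)])$, where $[x]$ is the $\sim$-class of $x$. Put $\mathrm{Ret}^0(X,r)=(X,r)$, $\mathrm{Ret}^1(X,r)=\mathrm{Ret}(X,r)$ and $\mathrm{Ret}^k(X,r)=\mathrm{Ret}(\mathrm{Ret}^{k-1}(X,r))$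 for $k>1$. $(X,r)$ is a multipermutation solution of level $m$ if $m$ is the smallest nonnegative integer such that the underlying set of $\mathrm{Ret}^m(X,r)$ has cardinality $1$. An elementary abelian $2$-group is a group in which $g^2=1$ for every element $g$; the trivial group is included. *)

theory Defs
  imports "HOL-Library.Disjoint_Sets" "HOL-Algebra.Bij" "HOL-Algebra.Elementary_Groups"
begin

text \<open>
  A pair (X, r) is given by a carrier \<open>X\<close> and a map \<open>r\<close> on pairs, of which only the values on
  \<open>X \<times> X\<close> matter. We write \<open>r (x, y) = (\<sigma>\<^sub>x(y), \<gamma>\<^sub>y(x))\<close>; the maps \<open>\<sigma>\<^sub>x\<close> and \<open>\<gamma>\<^sub>y\<close> are
  extensional, so that they can be elements of \<open>BijGroup X\<close>, and so that \<open>\<sigma>\<^sub>x = \<sigma>\<^sub>y\<close> means equality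
  as maps on \<open>X\<close>.
\<close>

type_synonym 'a pair_map = "'a \<times> 'a \<Rightarrow> 'a \<times> 'a"

definition sigma :: "'a set \<Rightarrow> 'a pair_map \<Rightarrow> 'a \<Rightarrow> 'a \<Rightarrow> 'a" where
  "sigma X r x = (\<lambda>y\<in>X. fst (r (x, y)))"

definition gamma :: "'a set \<Rightarrow> 'a pair_map \<Rightarrow> 'a \<Rightarrow> 'a \<Rightarrow> 'a" where
  "gamma X r y = (\<lambda>x\<in>X. snd (r (x, y)))"

definition r1 :: "'a pair_map \<Rightarrow> 'a \<times> 'a \<times> 'a \<Rightarrow> 'a \<times> 'a \<times> 'a" where
  "r1 r = (\<lambda>(x, y, z). (fst (r (x, y)), snd (r (x, y)), z))"

definition r2 :: "'a pair_map \<Rightarrow> 'a \<times> 'a \<times> 'a \<Rightarrow> 'a \<times> 'a \<times> 'a" where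
  "r2 r = (\<lambda>(x, y, z). (x, r (y, z)))"

text \<open>Non-degenerate involutive set-theoretic solutions of the Yang-Baxter equation.\<close>

definition nd_inv_solution :: "'a set \<Rightarrow> 'a pair_map \<Rightarrow> bool" where
  "nd_inv_solution X r \<longleftrightarrow>
     X \<noteq> {} \<and>
     r \<in> X \<times> X \<rightarrow> X \<times> X \<and>
     (\<forall>p\<in>X \<times> X. r (r p) = p) \<and>
     (\<forall>x\<in>X. bij_betw (sigma X r x) X X \<and> bij_betw (gamma X r x) X X) \<and>
     (\<forall>t\<in>X \<times> X \<times> X. r1 r (r2 r (r1 r t)) = r2 r (r1 r (r2 r t)))"

definition square_free :: "'a set \<Rightarrow> 'a pair_map \<Rightarrow> bool" where
  "square_free X r \<longleftrightarrow> (\<forall>x\<in>X. r (x, x) = (x, x))"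

text \<open>
  \<open>subgroup_generated\<close> intersects the generating set with the carrier, which is vacuous here: for a
  non-degenerate solution every \<open>\<sigma>\<^sub>x\<close> lies in \<open>BijGroup X\<close>.
\<close>

definition IYB_group :: "'a set \<Rightarrow> 'a pair_map \<Rightarrow> ('a \<Rightarrow> 'a) monoid" where
  "IYB_group X r = subgroup_generated (BijGroup X) (sigma X r ` X)"

definition elementary_abelian_2_group :: "('g, 'm) monoid_scheme \<Rightarrow> bool" where
  "elementary_abelian_2_group G \<longleftrightarrow>
     group G \<and> (\<forall>g\<in>carrier G. g [^]\<^bsub>G\<^esub> (2::nat) = \<one>\<^bsub>G\<^esub>)"

definition ret_rel :: "'a set \<Rightarrow> 'a pair_map \<Rightarrow> ('a \<times> 'a) set" where
  "ret_rel X r = {(x, y) \<in> X \<times> X. sigma X r x = sigma X r y}"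

text \<open>
  The induced map \<open>([x], [y]) \<mapsto> ([\<sigma>\<^sub>x(y)], [\<gamma>\<^sub>y(x)])\<close>. As usual for functions on quotients, the value
  is the union over all representatives; for a solution all the classes in that union coincide.
\<close>

definition ret_map :: "'a set \<Rightarrow> 'a pair_map \<Rightarrow> 'a set pair_map" where
  "ret_map X r = (\<lambda>(A, B).
     (\<Union>x\<in>A. \<Union>y\<in>B. ret_rel X r `` {sigma X r x y},
      \<Union>x\<in>A. \<Union>y\<in>B. ret_rel X r `` {gamma X r y x}))"

definition Ret :: "'a set \<times> 'a pair_map \<Rightarrow> 'a set set \<times> 'a set pair_map" where
  "Ret = (\<lambda>(X, r). (X // ret_rel X r, ret_map X r))"

text \<open>Transport of structure along a map \<open>f\<close> that is injective on the carrier.\<close>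

definition transport :: "('a \<Rightarrow> 'b) \<Rightarrow> 'a set \<times> 'a pair_map \<Rightarrow> 'b set \<times> 'b pair_map" where
  "transport f = (\<lambda>(Y, s).
     (f ` Y, \<lambda>(a, b). map_prod f f (s (inv_into Y f a, inv_into Y f b))))"

text \<open>
  Literally, the underlying set of the \<open>k\<close>-th retraction would have a type depending on \<open>k\<close>
  (a set of sets of ... of elements of \<open>X\<close>). To keep one type, an element \<open>x\<close> of \<open>X\<close> is
  identified with \<open>{x}\<close>, and each class of subsets of \<open>X\<close> with its union, so that every iterated
  retraction lives on a partition of \<open>X\<close>. These identifications are injective on the carriers
  concerned (\<open>inj_on_singleton\<close> and \<open>inj_on_Union_Ret\<close> below), so up to isomorphism nothing but
  \<open>Ret\<close> is applied.
\<close>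

primrec Ret_iter :: "'a set \<Rightarrow> 'a pair_map \<Rightarrow> nat \<Rightarrow> 'a set set \<times> 'a set pair_map" where
  "Ret_iter X r 0 = transport (\<lambda>x. {x}) (X, r)"
| "Ret_iter X r (Suc k) = transport \<Union> (Ret (Ret_iter X r k))"

definition multipermutation_level :: "'a set \<Rightarrow> 'a pair_map \<Rightarrow> nat \<Rightarrow> bool" where
  "multipermutation_level X r m \<longleftrightarrow>
     card (fst (Ret_iter X r m)) = 1 \<and> (\<forall>k<m. card (fst (Ret_iter X r k)) \<noteq> 1)"

lemma inj_on_singleton: "inj_on (\<lambda>x. {x}) X"
  by simp

lemma equiv_ret_rel: "equiv X (ret_rel X r)"
  by (auto simp: equiv_def refl_on_def sym_def trans_def ret_rel_def)

lemma partition_on_Union_image: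
  assumes P: "partition_on X P" and Q: "partition_on P Q"
  shows "partition_on X (\<Union> ` Q)"
proof (rule partition_onI)
  show "\<Union> (\<Union> ` Q) = X"
    unfolding partition_onD1[OF P] partition_onD1[OF Q] by blast
next
  have "p \<noteq> {}" if "p \<in> \<Union> ` Q" for p
  proof -
    from that obtain C where C: "C \<in> Q" "p = \<Union> C" by blast
    have "C \<noteq> {}" using C(1) partition_onD3[OF Q] by metis
    moreover have "C \<subseteq> P" using C(1) partition_onD1[OF Q] by blast
    ultimately obtain A where A: "A \<in> C" "A \<in> P" by blast
    then have "A \<noteq> {}" using partition_onD3[OF P] by metis
    then show ?thesis using C(2) A(1) by blast
  qed
  then show "{} \<notin> \<Union> ` Q" by metis
next
  fix p q assume "p \<in> \<Union> ` Q" "q \<in> \<Union> ` Q" "p \<noteq> q"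
  then obtain C D where C: "C \<in> Q" "p = \<Union> C" and D: "D \<in> Q" "q = \<Union> D" and "C \<noteq> D"
    by blast
  have sub: "C \<subseteq> P" "D \<subseteq> P" using C(1) D(1) partition_onD1[OF Q] by blast+
  have CD: "C \<inter> D = {}"
    using disjointD[OF partition_onD2[OF Q] C(1) D(1) \<open>C \<noteq> D\<close>] .
  have "A \<inter> B = {}" if "A \<in> C" "B \<in> D" for A B
  proof (rule disjointD[OF partition_onD2[OF P]])
    show "A \<in> P" "B \<in> P" "A \<noteq> B" using that sub CD by blast+
  qed
  then show "disjnt p q" unfolding C(2) D(2) disjnt_def by blast
qed

lemma partition_on_Ret_iter: "partition_on X (fst (Ret_iter X r k))"
proof (induction k)
  case 0
  show ?case by (simp add: transport_def partition_on_singletons)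
next
  case (Suc k)
  have "fst (Ret_iter X r (Suc k)) =
      \<Union> ` (fst (Ret_iter X r k) // ret_rel (fst (Ret_iter X r k)) (snd (Ret_iter X r k)))"
    by (simp add: transport_def Ret_def split_beta)
  then show ?case
    using partition_on_Union_image[OF Suc partition_on_quotient[OF equiv_ret_rel]] by simp
qed

lemma inj_on_Union_Ret: "inj_on \<Union> (fst (Ret (Ret_iter X r k)))"
proof (rule inj_onI)
  define P s where "P = fst (Ret_iter X r k)" and "s = snd (Ret_iter X r k)"
  have P: "partition_on X P"
    by (simp add: P_def partition_on_Ret_iter)
  fix C D assume "C \<in> fst (Ret (Ret_iter X r k))" "D \<in> fst (Ret (Ret_iter X r k))"
    and eq: "\<Union> C = \<Union> D"
  then have "C \<in> P // ret_rel P s" "D \<in> P // ret_rel P s"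
    by (simp_all add: Ret_def P_def s_def split_beta)
  then have sub: "C \<subseteq> P" "D \<subseteq> P"
    by (auto simp: quotient_def ret_rel_def)
  have *: "C' \<subseteq> D'" if C': "C' \<subseteq> P" and D': "D' \<subseteq> P" and U: "\<Union> C' = \<Union> D'" for C' D'
  proof
    fix A assume A: "A \<in> C'"
    then have "A \<noteq> {}" using C' partition_onD3[OF P] by (metis subsetD)
    then obtain a where a: "a \<in> A" by blast
    then have "a \<in> \<Union> D'" unfolding U[symmetric] using A by blast
    then obtain B where B: "B \<in> D'" "a \<in> B" by blast
    have "A = B"
    proof (rule ccontr)
      assume "A \<noteq> B"
      with A B C' D' have "A \<inter> B = {}"
        by (meson P disjointD partition_onD2 subsetD)
      with a B show False by blast
    qed
    with B show "A \<in> D'" by simp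
  qed
  show "C = D"
    using *[OF sub eq] *[OF sub(2,1) eq[symmetric]] by (rule equalityI)
qed

end

theory Submission
  imports Defs "HOL-Library.Poly_Mapping" "HOL-Library.Z2"
begin

text \<open>
  A commutative ring \<open>R\<close> without unit, of characteristic 2 and with \<open>a\<^sup>2 = 0\<close> for all \<open>a\<close>, carries the
  square-free solution \<open>r(a, b) = (b + ab, a + ab)\<close>. Its maps \<open>\<sigma>\<^sub>a\<close> are the multiplications by
  \<open>1 + a\<close>, so they form an elementary abelian 2-group, and \<open>\<sigma>\<^sub>a = \<sigma>\<^sub>b\<close> iff \<open>a - b\<close> annihilates \<open>R\<close>.
  Hence the \<open>k\<close>-th retraction is \<open>R\<close> modulo the \<open>k\<close>-th term of its upper annihilator series, and
  the multipermutation level is the least \<open>m\<close> with \<open>R\<^sup>m\<^sup>+\<^sup>1 = 0\<close>. The augmentation ideal of the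
  group algebra of \<open>(\<int>/2)\<^sup>n\<close> over the field with two elements has \<open>R\<^sup>n \<noteq> 0 = R\<^sup>n\<^sup>+\<^sup>1\<close>.
\<close>

section \<open>Iterated retractions\<close>

text \<open>Every iterated retraction becomes a quotient of \<open>X\<close> itself: two classes at
  level \<open>k\<close> have equal \<open>sigma\<close> exactly when their representatives act
  alike modulo \<open>E k\<close>, which is the recursion \<open>ESuc\<close>. The conclusion also
  records the induced map, because the next retraction is computed from it.\<close>

lemma Ret_iter_eq:
  assumes r: "\<And>x y. x \<in> X \<Longrightarrow> y \<in> X \<Longrightarrow> r (x, y) = (s x y, g x y)"
    and closed: "\<And>x y. x \<in> X \<Longrightarrow> y \<in> X \<Longrightarrow> s x y \<in> X" "\<And>x y. x \<in> X \<Longrightarrow> y \<in> X \<Longrightarrow> g x y \<in> X"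
    and equiv: "\<And>k. equiv X (E k)"
    and E0: "E 0 = Id_on X"
    and ESuc: "\<And>k x y. (x, y) \<in> E (Suc k) \<longleftrightarrow> x \<in> X \<and> y \<in> X \<and> (\<forall>z\<in>X. (s x z, s y z) \<in> E k)"
    and cong: "\<And>k x x' y y'. (x, x') \<in> E k \<Longrightarrow> (y, y') \<in> E k \<Longrightarrow> (s x y, s x' y') \<in> E k"
      "\<And>k x x' y y'. (x, x') \<in> E k \<Longrightarrow> (y, y') \<in> E k \<Longrightarrow> (g x y, g x' y') \<in> E k"
  shows "fst (Ret_iter X r k) = X // E k \<and> (\<forall>x\<in>X. \<forall>y\<in>X.
    snd (Ret_iter X r k) (E k `` {x}, E k `` {y}) = (E k `` {s x y}, E k `` {g x y}))"
proof (induction k)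
  case 0
  have [simp]: "Id_on X `` {x} = {x}" if "x \<in> X" for x
    using that by auto
  have "inv_into X (\<lambda>x. {x}) {x} = x" if "x \<in> X" for x
    using that by (metis inj_on_singleton inv_into_f_f)
  then show ?case
    by (auto simp: transport_def E0 r closed quotient_def)
next
  case (Suc k)
  \<comment> \<open>\<open>c x\<close> is the point of the \<open>k\<close>-th retraction given by
    \<open>x\<close>; \<open>D x\<close> is its retraction class, a set of such points before
    flattening by union.\<close>
  define P t where "P = fst (Ret_iter X r k)" and "t = snd (Ret_iter X r k)"
  define c where "c x = E k `` {x}" for x
  define D where "D x = ret_rel P t `` {c x}" for x
  have P: "P = c ` X"
    using Suc by (auto simp: P_def c_def quotient_def)
  have t: "t (c x, c y) = (c (s x y), c (g x y))" if "x \<in> X" "y \<in> X" for x y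
    using Suc that by (simp add: t_def c_def)
  have c_eq: "c x = c y \<longleftrightarrow> (x, y) \<in> E k" if "x \<in> X" "y \<in> X" for x y
    unfolding c_def using eq_equiv_class_iff[OF equiv that] .
  have sg: "sigma P t (c x) (c y) = c (s x y)" "gamma P t (c y) (c x) = c (g x y)"
    if "x \<in> X" "y \<in> X" for x y
    using that by (auto simp: sigma_def gamma_def P t)
  have sigma_eq: "sigma P t (c x) = sigma P t (c y) \<longleftrightarrow> (x, y) \<in> E (Suc k)"
    if "x \<in> X" "y \<in> X" for x y
  proof
    assume eq: "sigma P t (c x) = sigma P t (c y)"
    have "(s x z, s y z) \<in> E k" if "z \<in> X" for z
      using sg(1)[OF \<open>x \<in> X\<close> that] sg(1)[OF \<open>y \<in> X\<close> that] eq c_eq closed that \<open>x \<in> X\<close> \<open>y \<in> X\<close>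
      by metis
    then show "(x, y) \<in> E (Suc k)" using that by (simp add: ESuc)
  next
    assume "(x, y) \<in> E (Suc k)"
    then have "c (s x z) = c (s y z)" if "z \<in> X" for z
      using that c_eq closed by (simp add: ESuc)
    then show "sigma P t (c x) = sigma P t (c y)"
      using that by (auto simp: sigma_def fun_eq_iff P t)
  qed
  have D: "D x = c ` (E (Suc k) `` {x})" if "x \<in> X" for x
  proof -
    have "D x = c ` {y \<in> X. sigma P t (c x) = sigma P t (c y)}"
      using that by (auto simp: D_def ret_rel_def P)
    also have "{y \<in> X. sigma P t (c x) = sigma P t (c y)} = E (Suc k) `` {x}"
      using sigma_eq[OF that] by (auto simp del: ESuc) (auto simp: ESuc)
    finally show ?thesis .
  qed
  \<comment> \<open>Congruence of \<open>s\<close> makes \<open>E k\<close> a subset of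
    \<open>E (Suc k)\<close>, so an \<open>E (Suc k)\<close>-class is a union of
    \<open>E k\<close>-classes.\<close>
  have UD: "\<Union> (D x) = E (Suc k) `` {x}" if x: "x \<in> X" for x
  proof -
    have sub: "E k \<subseteq> E (Suc k)"
    proof clarify
      fix y z assume yz: "(y, z) \<in> E k"
      then have "y \<in> X" "z \<in> X" using equiv[of k] by (auto simp: equiv_def)
      moreover have "(w, w) \<in> E k" if "w \<in> X" for w
        using equiv[of k] that by (auto simp: equiv_def refl_on_def)
      ultimately show "(y, z) \<in> E (Suc k)" using cong(1)[OF yz] by (simp add: ESuc)
    qed
    have tr: "trans (E (Suc k))"
      using equiv[of "Suc k"] by (simp add: equiv_def)
    show ?thesis
    proof (intro equalityI subsetI)
      fix z assume "z \<in> \<Union> (D x)"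
      then obtain y where "(x, y) \<in> E (Suc k)" "(y, z) \<in> E k"
        by (auto simp: D[OF x] c_def simp del: ESuc)
      then show "z \<in> E (Suc k) `` {x}"
        using sub transD[OF tr] by blast
    next
      fix z assume z: "z \<in> E (Suc k) `` {x}"
      then have "z \<in> c z"
        using equiv_class_self[OF equiv] by (simp add: c_def ESuc)
      with z show "z \<in> \<Union> (D x)"
        unfolding D[OF x] by blast
    qed
  qed
  have D_eq: "D x = D y" if "(x, y) \<in> E (Suc k)" for x y
    using that equiv_class_eq[OF equiv that] by (simp add: D ESuc)
  have cls: "P // ret_rel P t = D ` X"
    by (auto simp: quotient_def D_def P)
  have iter: "Ret_iter X r (Suc k) = transport \<Union> (D ` X, ret_map P t)"
    by (simp add: Ret_def P_def t_def split_beta cls[unfolded P_def t_def])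
  have inj: "inj_on \<Union> (D ` X)"
    using inj_on_Union_Ret[of X r k]
    by (simp add: Ret_def split_beta cls[unfolded P_def t_def])
  \<comment> \<open>By congruence all representatives give the same class, and \<open>D x\<close>
    and \<open>D y\<close> are nonempty, so the unions in \<open>ret_map\<close> collapse to that
    class.\<close>
  have ret: "ret_map P t (D x, D y) = (D (s x y), D (g x y))" if xy: "x \<in> X" "y \<in> X" for x y
  proof -
    have val: "ret_rel P t `` {sigma P t A B} = D (s x y)" "ret_rel P t `` {gamma P t B A} = D (g x y)"
      if AB: "A \<in> D x" "B \<in> D y" for A B
    proof -
      obtain x' y' where x': "(x, x') \<in> E (Suc k)" "A = c x'" and y': "(y, y') \<in> E (Suc k)" "B = c y'"
        using AB by (auto simp: D xy)
      then have "x' \<in> X" "y' \<in> X" by (simp_all add: ESuc)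
      then show "ret_rel P t `` {sigma P t A B} = D (s x y)" "ret_rel P t `` {gamma P t B A} = D (g x y)"
        using D_eq[OF cong(1)[OF x'(1) y'(1)]] D_eq[OF cong(2)[OF x'(1) y'(1)]]
        by (simp_all add: x' y' sg flip: D_def)
    qed
    have "c x \<in> D x" "c y \<in> D y"
      using xy equiv_class_self[OF equiv] by (auto simp: D)
    then have *: "(\<Union>A\<in>D x. \<Union>B\<in>D y. K) = K" for K :: "'a set set"
      by auto
    show ?thesis
      unfolding ret_map_def prod.case by (simp only: val * cong: SUP_cong)
  qed
  show ?case
  proof (intro conjI ballI)
    show "fst (Ret_iter X r (Suc k)) = X // E (Suc k)"
      unfolding iter by (auto simp: transport_def UD quotient_def image_image)
    fix x y assume xy: "x \<in> X" "y \<in> X"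
    have "inv_into (D ` X) \<Union> (E (Suc k) `` {z}) = D z" if "z \<in> X" for z
      using inv_into_f_f[OF inj, of "D z"] UD[OF that] that by simp
    then show "snd (Ret_iter X r (Suc k)) (E (Suc k) `` {x}, E (Suc k) `` {y})
        = (E (Suc k) `` {s x y}, E (Suc k) `` {g x y})"
      unfolding iter using xy by (simp add: transport_def ret UD closed)
  qed
qed

section \<open>The solution on a ring with zero squares\<close>

text \<open>The injection \<open>e\<close> moves the solution to a prescribed type.\<close>

locale square_zero_ring =
  fixes R :: "'a::comm_ring set" and e :: "'a \<Rightarrow> 'b"
  assumes inj_e: "inj_on e R"
    and zero: "0 \<in> R"
    and add: "\<And>a b. a \<in> R \<Longrightarrow> b \<in> R \<Longrightarrow> a + b \<in> R"
    and mult: "\<And>a b. a \<in> R \<Longrightarrow> b \<in> R \<Longrightarrow> a * b \<in> R"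
    and double: "\<And>a. a \<in> R \<Longrightarrow> a + a = 0"
    and square: "\<And>a. a \<in> R \<Longrightarrow> a * a = 0"
begin

definition d :: "'b \<Rightarrow> 'a" where
  "d = inv_into R e"

definition X :: "'b set" where
  "X = e ` R"

text \<open>Multiplication by \<open>1 + a\<close>, expanded because \<open>R\<close> need not
  contain a unit.\<close>

definition act :: "'a \<Rightarrow> 'a \<Rightarrow> 'a" where
  "act a b = b + a * b"

definition s :: "'b \<Rightarrow> 'b \<Rightarrow> 'b" where
  "s x y = e (act (d x) (d y))"

text \<open>Both components use the same operation, so \<open>sigma\<close> and \<open>gamma\<close>
  agree on \<open>X\<close>.\<close>

definition sol :: "'b pair_map" where
  "sol = (\<lambda>(x, y). (s x y, s y x))"

lemma d_e [simp]: "a \<in> R \<Longrightarrow> d (e a) = a"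
  by (simp add: d_def inj_e)

lemma e_in_X [simp]: "a \<in> R \<Longrightarrow> e a \<in> X"
  by (simp add: X_def)

lemma X_cases [elim!]:
  assumes "x \<in> X"
  obtains a where "a \<in> R" "x = e a"
  using assms by (auto simp: X_def)

lemma act_in [simp]: "a \<in> R \<Longrightarrow> b \<in> R \<Longrightarrow> act a b \<in> R"
  by (simp add: act_def add mult)

lemma s_in [simp]: "x \<in> X \<Longrightarrow> y \<in> X \<Longrightarrow> s x y \<in> X"
  by (auto simp: X_def s_def)

lemma s_e [simp]: "a \<in> R \<Longrightarrow> b \<in> R \<Longrightarrow> s (e a) (e b) = e (act a b)"
  by (simp add: s_def)

lemma sol_e [simp]: "a \<in> R \<Longrightarrow> b \<in> R \<Longrightarrow> sol (e a, e b) = (e (act a b), e (act b a))"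
  by (simp add: sol_def)

text \<open>This is \<open>(1 + a)(1 + b) = 1 + (a + b + ab)\<close>, the circle operation of the
  ring.\<close>

lemma act_act: "act a (act b c) = act (a + b + a * b) c"
  by (simp add: act_def algebra_simps)

lemma uminus_eq: "a \<in> R \<Longrightarrow> - a = a"
  using double by (metis minus_unique)

lemma act_self: "a \<in> R \<Longrightarrow> act a a = a"
  by (simp add: act_def square)

text \<open>Here \<open>(1 + a)(1 + a) = 1 + 2a + a * a = 1\<close>.\<close>

lemma act_involutive: "a \<in> R \<Longrightarrow> act a (act a b) = b"
  by (simp add: act_act double square) (simp add: act_def)

text \<open>The first component of \<open>sol (sol p) = p\<close>; exchanging \<open>a\<close> and
  \<open>b\<close> gives the second.\<close>

lemma act_act_self: "a \<in> R \<Longrightarrow> b \<in> R \<Longrightarrow> act (act a b) (act b a) = a"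
proof -
  assume ab: "a \<in> R" "b \<in> R"
  have "act (act a b) (act b a) = a + (a * b + a * b) + a * b * b + a * a * b + (a * a) * (b * b)"
    by (simp add: act_def algebra_simps)
  also have "\<dots> = a"
    using ab by (simp add: double mult square mult.assoc[of a b b])
  finally show ?thesis .
qed

text \<open>The first component of the braid relation; exchanging \<open>a\<close> and
  \<open>c\<close> gives the third. By \<open>act_act\<close> it suffices that
  \<open>act a b\<close> and \<open>act b a\<close> have the same circle product as \<open>a\<close>
  and \<open>b\<close>.\<close>

lemma act_braid:
  assumes "a \<in> R" "b \<in> R"
  shows "act (act a b) (act (act b a) c) = act a (act b c)"
proof -
  have "act a b + act b a + act a b * act b a =
      a + b + a * b + a * b + a * b + a * b * b + a * a * b + (a * a) * (b * b)"
    by (simp add: act_def algebra_simps)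
  also have "\<dots> = a + b + a * b"
    using assms by (simp add: double mult square mult.assoc[of a b b] add.assoc[of "a + b"])
  finally show ?thesis by (simp add: act_act)
qed

text \<open>The middle components on the two sides of the braid relation differ by exchanging
  \<open>a\<close> and \<open>c\<close>, and the value found here is symmetric in them.\<close>

lemma act_middle:
  assumes "a \<in> R" "b \<in> R" "c \<in> R"
  shows "act (act (act b a) c) (act a b) = b + a * b + c * b"
proof -
  have "act (act (act b a) c) (act a b) = b + a * b + c * b + (a * (c * b) + a * (c * b))
      + (a * a) * (c * b) + (b * b) * (a * c) + (a * a) * ((b * b) * c)"
    by (simp add: act_def algebra_simps)
  then show ?thesis
    using assms by (simp add: double mult square)
qed

lemma sigma_sol: "x \<in> X \<Longrightarrow> sigma X sol x = (\<lambda>y\<in>X. s x y)"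
  by (auto simp: sigma_def sol_def)

lemma gamma_sol: "x \<in> X \<Longrightarrow> gamma X sol x = (\<lambda>y\<in>X. s x y)"
  by (auto simp: gamma_def sol_def)

lemma s_involutive: "x \<in> X \<Longrightarrow> y \<in> X \<Longrightarrow> s x (s x y) = y"
  by (auto simp: X_def act_involutive)

lemma bij_s: "x \<in> X \<Longrightarrow> bij_betw (s x) X X"
  by (rule bij_betw_byWitness[where f' = "s x"]) (auto simp: s_involutive)

lemma nd_inv_solution_sol: "nd_inv_solution X sol"
  unfolding nd_inv_solution_def
proof (intro conjI ballI)
  show "X \<noteq> {}" using zero by (auto simp: X_def)
  show "sol \<in> X \<times> X \<rightarrow> X \<times> X" by (auto simp: sol_def)
  fix p assume "p \<in> X \<times> X"
  then show "sol (sol p) = p"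
    by (auto simp: X_def act_act_self)
next
  fix x assume "x \<in> X"
  then show "bij_betw (sigma X sol x) X X" "bij_betw (gamma X sol x) X X"
    by (simp_all add: sigma_sol gamma_sol bij_s)
next
  fix t assume "t \<in> X \<times> X \<times> X"
  then obtain a b c where "a \<in> R" "b \<in> R" "c \<in> R" "t = (e a, e b, e c)"
    by (auto simp: X_def)
  then show "r1 sol (r2 sol (r1 sol t)) = r2 sol (r1 sol (r2 sol t))"
    by (simp add: r1_def r2_def act_braid act_middle add_ac)
qed

lemma square_free_sol: "square_free X sol"
  by (auto simp: square_free_def X_def act_self)

section \<open>The permutation group of the solution\<close>

lemma sigma_in_Bij: "x \<in> X \<Longrightarrow> sigma X sol x \<in> Bij X"
  by (simp add: Bij_def sigma_sol bij_s)

lemma sigma_mult: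
  assumes "a \<in> R" "b \<in> R"
  shows "sigma X sol (e a) \<otimes>\<^bsub>BijGroup X\<^esub> sigma X sol (e b) = sigma X sol (e (a + b + a * b))"
proof -
  have "sigma X sol (e a) \<otimes>\<^bsub>BijGroup X\<^esub> sigma X sol (e b)
      = compose X (sigma X sol (e a)) (sigma X sol (e b))"
    using assms by (simp add: BijGroup_def sigma_in_Bij)
  also have "\<dots> = sigma X sol (e (a + b + a * b))"
    using assms by (auto simp: fun_eq_iff compose_def sigma_sol add mult act_act)
  finally show ?thesis .
qed

lemma sigma_one: "sigma X sol (e 0) = \<one>\<^bsub>BijGroup X\<^esub>"
  using zero by (auto simp: fun_eq_iff sigma_sol BijGroup_def act_def)

lemma elementary_abelian_2_group_sol: "elementary_abelian_2_group (IYB_group X sol)"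
proof -
  interpret G: group "BijGroup X" by (rule group_BijGroup)
  define H where "H = subgroup_generated (BijGroup X) (sigma X sol ` X)"
  interpret H: group H unfolding H_def by simp
  have car: "sigma X sol (e a) \<in> carrier (BijGroup X)" if "a \<in> R" for a
    using that by (simp add: BijGroup_def sigma_in_Bij)
  have sq: "sigma X sol (e a) \<otimes>\<^bsub>BijGroup X\<^esub> sigma X sol (e a) = \<one>\<^bsub>BijGroup X\<^esub>"
    if "a \<in> R" for a
    using that by (simp add: sigma_mult double square sigma_one)
  \<comment> \<open>The generators already exhaust the group: products follow the circle operation,
    and each generator is its own inverse.\<close>
  have gen: "\<exists>a\<in>R. g = sigma X sol (e a)" if "g \<in> generate (BijGroup X) (sigma X sol ` X)" for g
    using that
  proof (induction rule: generate.induct)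
    case one
    show ?case using zero sigma_one by metis
  next
    case (incl h)
    then show ?case by auto
  next
    case (inv h)
    then obtain a where a: "a \<in> R" "h = sigma X sol (e a)" by auto
    then have "inv\<^bsub>BijGroup X\<^esub> h = h"
      using G.inv_equality[OF sq[OF a(1)] car[OF a(1)] car[OF a(1)]] by simp
    with a show ?case by auto
  next
    case (eng h1 h2)
    then obtain a b where "a \<in> R" "b \<in> R" "h1 = sigma X sol (e a)" "h2 = sigma X sol (e b)"
      by blast
    then show ?case by (auto simp: sigma_mult intro!: bexI[of _ "a + b + a * b"] add mult)
  qed
  have inter: "carrier (BijGroup X) \<inter> sigma X sol ` X = sigma X sol ` X"
    using car by auto
  have "g [^]\<^bsub>H\<^esub> (2::nat) = \<one>\<^bsub>H\<^esub>" if g: "g \<in> carrier H" for g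
  proof -
    have "g \<in> generate (BijGroup X) (sigma X sol ` X)"
      using g inter by (simp add: H_def carrier_subgroup_generated)
    then obtain a where "a \<in> R" "g = sigma X sol (e a)" using gen by blast
    then have "g \<otimes>\<^bsub>H\<^esub> g = \<one>\<^bsub>H\<^esub>" by (simp add: H_def sq)
    then show ?thesis using g by (simp add: numeral_2_eq_2)
  qed
  then show ?thesis
    unfolding elementary_abelian_2_group_def IYB_group_def H_def[symmetric]
    using H.is_group by blast
qed

section \<open>The upper annihilator series and its congruences\<close>

primrec Ann :: "nat \<Rightarrow> 'a set" where
  "Ann 0 = {0}"
| "Ann (Suc k) = {a \<in> R. \<forall>b\<in>R. a * b \<in> Ann k}"

lemma Ann_subset: "Ann k \<subseteq> R"
  using zero by (cases k) auto

lemma zero_Ann [simp]: "0 \<in> Ann k"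
  by (induction k) (auto simp: zero)

lemma add_Ann: "a \<in> Ann k \<Longrightarrow> b \<in> Ann k \<Longrightarrow> a + b \<in> Ann k"
  by (induction k arbitrary: a b) (auto simp: add distrib_right)

lemma mult_Ann: "a \<in> Ann k \<Longrightarrow> b \<in> R \<Longrightarrow> a * b \<in> Ann k"
proof (induction k arbitrary: a b)
  case (Suc k)
  then have "a * b * c \<in> Ann k" if "c \<in> R" for c
    using that by (simp add: mult.assoc mult)
  with Suc show ?case by (simp add: mult)
qed simp

text \<open>In characteristic 2 the sum is the difference, so this is congruence modulo
  \<open>Ann k\<close>.\<close>

definition E :: "nat \<Rightarrow> ('b \<times> 'b) set" where
  "E k = {(x, y) \<in> X \<times> X. d x + d y \<in> Ann k}"

lemma E_e [simp]: "a \<in> R \<Longrightarrow> b \<in> R \<Longrightarrow> (e a, e b) \<in> E k \<longleftrightarrow> a + b \<in> Ann k"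
  by (simp add: E_def)

lemma equiv_E: "equiv X (E k)"
proof (rule equivI)
  show "E k \<subseteq> X \<times> X" by (auto simp: E_def)
  show "refl_on X (E k)"
    by (auto simp: refl_on_def X_def double)
  show "sym (E k)"
    by (auto simp: sym_def E_def add.commute)
  show "trans (E k)"
  proof (rule transI)
    fix x y z assume xy: "(x, y) \<in> E k" and yz: "(y, z) \<in> E k"
    then obtain a b c where *: "a \<in> R" "b \<in> R" "c \<in> R" "x = e a" "y = e b" "z = e c"
      by (auto simp: E_def X_def)
    then have "(a + b) + (b + c) \<in> Ann k"
      using xy yz add_Ann by simp
    moreover have "(a + b) + (b + c) = a + (b + b) + c"
      by (simp add: algebra_simps)
    ultimately show "(x, z) \<in> E k"
      using * by (simp add: double)
  qed
qed

lemma E_0: "E 0 = Id_on X"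
proof -
  have eq: "a = b" if "a \<in> R" "b \<in> R" "a + b = 0" for a b
    using that uminus_eq by (metis eq_neg_iff_add_eq_0)
  then show ?thesis
    by (auto simp: E_def Id_on_iff double dest: eq)
qed

text \<open>The difference of \<open>act a c\<close> and \<open>act b c\<close> is
  \<open>(a + b) * c\<close>, so the recursion defining \<open>Ann\<close> is the one that governs
  retractions.\<close>

lemma E_Suc: "(x, y) \<in> E (Suc k) \<longleftrightarrow> x \<in> X \<and> y \<in> X \<and> (\<forall>z\<in>X. (s x z, s y z) \<in> E k)"
proof (cases "x \<in> X \<and> y \<in> X")
  case True
  then obtain a b where *: "a \<in> R" "b \<in> R" "x = e a" "y = e b"
    by (auto simp: X_def)
  have act_add: "act a c + act b c = (a + b) * c" if "c \<in> R" for c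
  proof -
    have "act a c + act b c = (c + c) + (a + b) * c"
      by (simp add: act_def algebra_simps)
    then show ?thesis using that by (simp add: double)
  qed
  have "(\<forall>z\<in>X. (s x z, s y z) \<in> E k) \<longleftrightarrow> (\<forall>c\<in>R. (a + b) * c \<in> Ann k)"
    unfolding X_def ball_simps using * by (simp add: act_add)
  with * show ?thesis
    by (simp add: add)
qed (auto simp: E_def)

lemma E_cong:
  assumes "(x, x') \<in> E k" "(y, y') \<in> E k"
  shows "(s x y, s x' y') \<in> E k"
proof -
  obtain a a' b b' where *: "a \<in> R" "a' \<in> R" "b \<in> R" "b' \<in> R"
      "x = e a" "x' = e a'" "y = e b" "y' = e b'"
    using assms by (auto simp: E_def X_def)
  \<comment> \<open>The vanishing term \<open>a * b' + a * b'\<close> splits the difference into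
    multiples of \<open>b + b'\<close> and \<open>a + a'\<close>.\<close>
  have "act a b + act a' b' + (a * b' + a * b') = (b + b') + (b + b') * a + (a + a') * b'"
    by (simp add: act_def algebra_simps)
  then have "act a b + act a' b' = (b + b') + (b + b') * a + (a + a') * b'"
    using * by (simp add: double mult)
  moreover have "(b + b') + (b + b') * a \<in> Ann k" "(a + a') * b' \<in> Ann k"
    using assms * add_Ann[of "b + b'" k "(b + b') * a"] mult_Ann by simp_all
  ultimately have "act a b + act a' b' \<in> Ann k"
    using add_Ann by simp
  then show ?thesis using * by simp
qed

lemma fst_Ret_iter: "fst (Ret_iter X sol k) = X // E k"
proof -
  have "fst (Ret_iter X sol k) = X // E k \<and> (\<forall>x\<in>X. \<forall>y\<in>X.
      snd (Ret_iter X sol k) (E k `` {x}, E k `` {y}) = (E k `` {s x y}, E k `` {s y x}))"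
    by (rule Ret_iter_eq[where g = "\<lambda>x y. s y x"])
       (simp add: sol_def | rule E_Suc equiv_E E_0 | blast intro: s_in E_cong)+
  then show ?thesis ..
qed

text \<open>There is a single class exactly when every element is congruent to 0.\<close>

lemma card_Ret_iter: "card (fst (Ret_iter X sol k)) = 1 \<longleftrightarrow> Ann k = R"
proof
  assume "card (fst (Ret_iter X sol k)) = 1"
  then obtain C where C: "X // E k = {C}"
    unfolding fst_Ret_iter by (rule card_1_singletonE)
  have "a \<in> Ann k" if "a \<in> R" for a
  proof -
    have "E k `` {e a} = C" "E k `` {e 0} = C"
      using C quotientI[of _ X "E k"] that zero e_in_X by (metis singletonD)+
    then have "(e a, e 0) \<in> E k"
      using eq_equiv_class_iff[OF equiv_E, of "e a" "e 0" k] that zero by simp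
    then show ?thesis using that zero by simp
  qed
  then show "Ann k = R" using Ann_subset by blast
next
  assume R: "Ann k = R"
  have "(x, y) \<in> E k" if "x \<in> X" "y \<in> X" for x y
    using that by (auto simp: R add)
  then have "E k `` {x} = X" if "x \<in> X" for x
    using that equiv_type[OF equiv_E, of k] by (simp add: set_eq_iff) (metis SigmaD2 subsetD)
  moreover have "e 0 \<in> X" using zero by simp
  ultimately have "X // E k = {X}"
    unfolding quotient_def by (metis (no_types, lifting) SUP_cong UN_constant empty_iff)
  then show "card (fst (Ret_iter X sol k)) = 1"
    by (simp add: fst_Ret_iter)
qed

lemma multipermutation_level_sol:
  assumes "Ann n = R" "\<And>k. k < n \<Longrightarrow> Ann k \<noteq> R"
  shows "multipermutation_level X sol n"
  using assms by (simp add: multipermutation_level_def card_Ret_iter del: One_nat_def)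

end

section \<open>The augmentation ideal of the group algebra\<close>

text \<open>Finitely supported bit sequences form the group, written additively, and the convolution
  product gives its group algebra. Having infinitely many generators lets one type serve every
  \<open>n\<close>.\<close>

type_synonym grp_alg = "(nat \<Rightarrow>\<^sub>0 bit) \<Rightarrow>\<^sub>0 bit"

text \<open>Multiplying by a group element translates the coefficients.\<close>

lemma lookup_single_mult:
  fixes f :: "'a::ab_group_add \<Rightarrow>\<^sub>0 'b::comm_semiring_1"
  shows "Poly_Mapping.lookup (Poly_Mapping.single g 1 * f) h = Poly_Mapping.lookup f (h - g)"
proof -
  have "h = g + q \<longleftrightarrow> q = h - g" for q
    by (auto simp: algebra_simps)
  then show ?thesis
    by (simp add: lookup_mult[abs_def] lookup_single[abs_def] when_mult)
qed

text \<open>With \<open>g\<^sub>i\<close> the \<open>i\<close>-th generator of the group, \<open>gen i\<close> is \<open>1 - g\<^sub>i\<close>.\<close>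

definition gen :: "nat \<Rightarrow> grp_alg" where
  "gen i = 1 + Poly_Mapping.single (Poly_Mapping.single i 1) 1"

lemma bit_double: "b + b = 0" for b :: bit
  by (cases b) simp_all

lemma grp_alg_double: "a + a = (0 :: grp_alg)"
  by (rule poly_mapping_eqI) (simp only: lookup_add lookup_zero bit_double)

text \<open>A generator \<open>g\<close> has order 2, so
  \<open>(1 + g)(1 + g) = 1 + 2g + 1 = 0\<close>.\<close>

lemma gen_square: "gen i * gen i = 0"
proof -
  have "Poly_Mapping.single i 1 + Poly_Mapping.single i 1 = (0 :: nat \<Rightarrow>\<^sub>0 bit)"
    by (simp only: bit_double single_zero flip: single_add)
  then have "Poly_Mapping.single (Poly_Mapping.single i 1) 1 * Poly_Mapping.single (Poly_Mapping.single i 1) 1 = (1 :: grp_alg)"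
    by (simp only: mult_single mult_1_left single_one)
  then have "gen i * gen i = (1 + 1) + (Poly_Mapping.single (Poly_Mapping.single i 1) 1 + Poly_Mapping.single (Poly_Mapping.single i 1) 1)"
    by (simp add: gen_def algebra_simps)
  then show ?thesis by (simp only: grp_alg_double add_0_left)
qed

definition gen_prod :: "nat set \<Rightarrow> grp_alg" where
  "gen_prod S = (\<Prod>i\<in>S. gen i)"

text \<open>A common index contributes a factor \<open>gen i * gen i\<close>, which is 0.\<close>

lemma gen_prod_mult:
  assumes "finite S" "finite T"
  shows "gen_prod S * gen_prod T = (if S \<inter> T = {} then gen_prod (S \<union> T) else 0)"
proof (cases "S \<inter> T = {}")
  case True
  then show ?thesis using assms by (simp add: gen_prod_def prod.union_disjoint)
next
  case False
  then obtain i where "i \<in> S" "i \<in> T" by blast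
  then have "gen_prod S * gen_prod T = (gen i * gen i) * (gen_prod (S - {i}) * gen_prod (T - {i}))"
    using assms by (simp add: gen_prod_def prod.remove[of _ i] mult_ac)
  then show ?thesis using False by (simp add: gen_square)
qed

section \<open>Powers of the augmentation ideal\<close>

text \<open>
  The \<open>j\<close>-th power (\<open>j \<ge> 1\<close>) of the augmentation ideal for \<open>n\<close> generators; sums of subsets of the
  spanning set are closed under addition because the characteristic is 2.
\<close>

definition aug_power :: "nat \<Rightarrow> nat \<Rightarrow> grp_alg set" where
  "aug_power n j = sum gen_prod ` Pow {S. S \<subseteq> {..<n} \<and> j \<le> card S}"

lemma finite_index: "finite {S. S \<subseteq> {..<n} \<and> j \<le> card S}" for n :: nat
  by (rule finite_subset[of _ "Pow {..<n}"]) auto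

lemma finite_aug_power: "finite (aug_power n j)"
  by (simp add: aug_power_def finite_index)

lemma aug_power_zero: "0 \<in> aug_power n j"
  by (auto simp: aug_power_def image_iff intro: bexI[of _ "{}"])

lemma gen_prod_in_aug_power: "S \<subseteq> {..<n} \<Longrightarrow> j \<le> card S \<Longrightarrow> gen_prod S \<in> aug_power n j"
  by (auto simp: aug_power_def image_iff intro!: bexI[of _ "{S}"])

lemma aug_power_add:
  assumes "a \<in> aug_power n j" "b \<in> aug_power n j"
  shows "a + b \<in> aug_power n j"
proof -
  let ?P = "{S. S \<subseteq> {..<n} \<and> j \<le> card S}"
  obtain A B where AB: "A \<subseteq> ?P" "B \<subseteq> ?P" "a = sum gen_prod A" "b = sum gen_prod B"
    using assms by (auto simp: aug_power_def)
  have fin: "finite A" "finite B"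
    using finite_subset[OF AB(1) finite_index] finite_subset[OF AB(2) finite_index] .
  have split: "sum gen_prod A = sum gen_prod (A - B) + sum gen_prod (A \<inter> B)"
    "sum gen_prod B = sum gen_prod (B - A) + sum gen_prod (A \<inter> B)"
    by (subst sum.Int_Diff[OF fin(1), where B = B], rule add.commute)
      (subst sum.Int_Diff[OF fin(2), where B = A], subst Int_commute, rule add.commute)
  \<comment> \<open>The overlap \<open>A \<inter> B\<close> occurs twice and cancels, leaving a sum
    over the symmetric difference.\<close>
  have "a + b = (sum gen_prod (A - B) + sum gen_prod (A \<inter> B)) + (sum gen_prod (B - A) + sum gen_prod (A \<inter> B))"
    unfolding AB(3,4) split(1) by (subst split(2)) (rule refl)
  also have "\<dots> = sum gen_prod (A - B) + sum gen_prod (B - A) + (sum gen_prod (A \<inter> B) + sum gen_prod (A \<inter> B))"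
    by (simp add: add_ac)
  also have "\<dots> = sum gen_prod ((A - B) \<union> (B - A))"
    using fin by (subst sum.union_disjoint) (auto simp: grp_alg_double)
  finally show ?thesis
    using AB by (auto simp: aug_power_def)
qed

lemma aug_power_sum:
  "(\<And>i. i \<in> I \<Longrightarrow> f i \<in> aug_power n j) \<Longrightarrow> sum f I \<in> aug_power n j"
  by (induction I rule: infinite_finite_induct) (auto simp: aug_power_zero aug_power_add)

text \<open>After expanding, disjoint index sets add their cardinalities and overlapping ones
  contribute 0.\<close>

lemma aug_power_mult:
  assumes "a \<in> aug_power n i" "b \<in> aug_power n j"
  shows "a * b \<in> aug_power n (i + j)"
proof -
  obtain A B where A: "A \<subseteq> {S. S \<subseteq> {..<n} \<and> i \<le> card S}" "a = sum gen_prod A"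
    and B: "B \<subseteq> {S. S \<subseteq> {..<n} \<and> j \<le> card S}" "b = sum gen_prod B"
    using assms by (auto simp: aug_power_def)
  have "gen_prod S * gen_prod T \<in> aug_power n (i + j)" if "S \<in> A" "T \<in> B" for S T
  proof -
    have *: "S \<subseteq> {..<n}" "T \<subseteq> {..<n}" "i \<le> card S" "j \<le> card T"
      using that A B by auto
    have "finite S" "finite T"
      using finite_subset[OF *(1)] finite_subset[OF *(2)] by simp_all
    show ?thesis
    proof (cases "S \<inter> T = {}")
      case True
      then have "i + j \<le> card (S \<union> T)"
        using * \<open>finite S\<close> \<open>finite T\<close> by (simp add: card_Un_disjoint)
      then show ?thesis
        using True * \<open>finite S\<close> \<open>finite T\<close> by (simp add: gen_prod_mult gen_prod_in_aug_power)
    qed (simp add: gen_prod_mult \<open>finite S\<close> \<open>finite T\<close> aug_power_zero)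
  qed
  then show ?thesis
    unfolding A B sum_product by (intro aug_power_sum)
qed

lemma aug_power_antimono: "i \<le> j \<Longrightarrow> aug_power n j \<subseteq> aug_power n i"
  unfolding aug_power_def by (intro image_mono) auto

lemma aug_power_vanish: "n < j \<Longrightarrow> aug_power n j = {0}"
proof -
  assume "n < j"
  moreover have "card S \<le> n" if "S \<subseteq> {..<n}" for S :: "nat set"
    using card_mono[OF _ that] by simp
  ultimately have "{S. S \<subseteq> {..<n} \<and> j \<le> card S} = {}" by (auto simp: not_le intro: le_less_trans)
  then show ?thesis unfolding aug_power_def by (simp only: Pow_empty) simp
qed

text \<open>In characteristic 2 squaring is additive, as each cross term occurs twice.\<close>

lemma sum_square_zero:
  fixes f :: "'i \<Rightarrow> grp_alg"
  assumes "\<And>i. i \<in> I \<Longrightarrow> f i * f i = 0"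
  shows "sum f I * sum f I = 0"
  using assms
proof (induction I rule: infinite_finite_induct)
  case (insert i I)
  have "sum f (insert i I) * sum f (insert i I)
      = f i * f i + sum f I * sum f I + (f i * sum f I + f i * sum f I)"
    using insert by (simp add: algebra_simps)
  with insert show ?case by (simp add: grp_alg_double)
qed auto

lemma aug_power_square:
  assumes "a \<in> aug_power n 1"
  shows "a * a = 0"
proof -
  obtain A where A: "A \<subseteq> {S. S \<subseteq> {..<n} \<and> 1 \<le> card S}" "a = sum gen_prod A"
    using assms by (auto simp: aug_power_def)
  \<comment> \<open>A nonempty set meets itself, so \<open>gen_prod_mult\<close> applies with
    overlap.\<close>
  have "gen_prod S * gen_prod S = 0" if "S \<in> A" for S
  proof -
    have "S \<noteq> {}" "S \<subseteq> {..<n}"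
      using that A by auto
    moreover from this have "finite S"
      using finite_subset[of S "{..<n}"] by simp
    ultimately show ?thesis by (simp add: gen_prod_mult)
  qed
  then show ?thesis unfolding A by (rule sum_square_zero)
qed

lemma gen_prod_nonzero: "gen_prod {..<n} \<noteq> 0"
proof -
  \<comment> \<open>The coefficient at the group identity is 1. The support condition carries the
    induction: the product so far does not involve generator \<open>n\<close>, so its translate by
    that generator adds nothing at the identity.\<close>
  have "(\<forall>g. Poly_Mapping.lookup (gen_prod {..<n}) g \<noteq> 0 \<longrightarrow> (\<forall>i\<ge>n. Poly_Mapping.lookup g i = 0)) \<and> Poly_Mapping.lookup (gen_prod {..<n}) 0 = 1"
  proof (induction n)
    case 0
    then show ?case by (auto simp: gen_prod_def lookup_one when_def)
  next
    case (Suc n)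
    let ?g = "Poly_Mapping.single n 1 :: nat \<Rightarrow>\<^sub>0 bit"
    have eq: "gen_prod {..<Suc n} = gen_prod {..<n} + Poly_Mapping.single ?g 1 * gen_prod {..<n}"
      by (simp add: gen_prod_def lessThan_Suc gen_def algebra_simps)
    have shift: "Poly_Mapping.lookup (Poly_Mapping.single ?g 1 * gen_prod {..<n}) g = Poly_Mapping.lookup (gen_prod {..<n}) (g - ?g)" for g
      by (rule lookup_single_mult)
    have "Poly_Mapping.lookup (gen_prod {..<n}) (0 - ?g) = 0"
    proof (rule ccontr)
      assume "Poly_Mapping.lookup (gen_prod {..<n}) (0 - ?g) \<noteq> 0"
      then have "Poly_Mapping.lookup (0 - ?g) n = 0" using Suc by blast
      then show False by (simp add: lookup_minus)
    qed
    moreover have "Poly_Mapping.lookup g i = 0"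
      if "Poly_Mapping.lookup (gen_prod {..<n}) (g - ?g) \<noteq> 0" "Suc n \<le> i" for g i
    proof -
      have "Poly_Mapping.lookup (g - ?g) i = 0" using Suc that by simp
      then show ?thesis using that by (simp add: lookup_minus lookup_single)
    qed
    ultimately show ?case
      using Suc by (auto simp: eq lookup_add shift)
  qed
  then show ?thesis by auto
qed

theorem theorem7p3:
  fixes n :: nat
  assumes "n > 0"
  shows "\<exists>(X :: nat set) (r :: nat pair_map).
    finite X \<and> nd_inv_solution X r \<and> square_free X r \<and>
    multipermutation_level X r n \<and>
    elementary_abelian_2_group (IYB_group X r)"
proof -
  \<comment> \<open>The ideal is finite, so it can be encoded in the natural numbers.\<close>
  obtain e :: "grp_alg \<Rightarrow> nat" where e: "inj_on e (aug_power n 1)"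
    using finite_imp_inj_to_nat_seg[OF finite_aug_power] by blast
  have mult: "a * b \<in> aug_power n 1" if "a \<in> aug_power n 1" "b \<in> aug_power n 1" for a b
    using aug_power_mult[OF that] aug_power_antimono[of 1 "1 + 1" n] by auto
  interpret square_zero_ring "aug_power n 1" e
    using e aug_power_zero aug_power_add mult grp_alg_double aug_power_square
    by unfold_locales
  \<comment> \<open>Each multiplication by an element of the ideal raises the power by one, and the
    power \<open>n + 1\<close> is zero. The case \<open>k = n\<close> puts the whole ideal into
    \<open>Ann n\<close>.\<close>
  have le: "aug_power n (Suc n - k) \<subseteq> Ann k" if "k \<le> n" for k
    using that
  proof (induction k)
    case 0
    then show ?case by (simp add: aug_power_vanish del: One_nat_def)
  next
    case (Suc k)
    have "a * b \<in> Ann k" if "a \<in> aug_power n (n - k)" "b \<in> aug_power n 1" for a b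
    proof -
      have "n - k + 1 = Suc n - k" using Suc.prems by simp
      then show ?thesis
        using aug_power_mult[OF that] Suc by auto
    qed
    moreover have "aug_power n (n - k) \<subseteq> aug_power n 1"
      using Suc.prems by (intro aug_power_antimono) simp
    ultimately show ?case by (auto simp del: One_nat_def)
  qed
  \<comment> \<open>Multiplying by the next generator increases \<open>j\<close> while
    \<open>k\<close> decreases; at \<open>k = 0\<close> the product of the first \<open>j\<close>
    generators is still nonzero. Hence \<open>j\<close> must be arbitrary in the induction.\<close>
  have nle: "gen_prod {..<j} \<notin> Ann k" if "j + k \<le> n" for j k
    using that
  proof (induction k arbitrary: j)
    case 0
    then show ?case by (simp add: gen_prod_nonzero del: One_nat_def)
  next
    case (Suc k)
    have "gen_prod {..<j} * gen_prod {j} = gen_prod {..<Suc j}"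
      by (subst gen_prod_mult) (auto simp: lessThan_Suc)
    moreover have "gen_prod {j} \<in> aug_power n 1"
      using Suc.prems by (intro gen_prod_in_aug_power) auto
    moreover have "gen_prod {..<Suc j} \<notin> Ann k"
      using Suc.prems by (intro Suc.IH) simp
    ultimately show ?case
      unfolding Ann.simps mem_Collect_eq by metis
  qed
  have "Ann n = aug_power n 1"
    using le[of n] Ann_subset by auto
  \<comment> \<open>The witness is \<open>gen_prod {..<1}\<close>, that is \<open>gen 0\<close>: it
    lies in the ideal, and \<open>1 + k \<le> n\<close> keeps it out of
    \<open>Ann k\<close>.\<close>
  moreover have "Ann k \<noteq> aug_power n 1" if "k < n" for k
    using nle[of 1 k] gen_prod_in_aug_power[of "{..<1}" n 1] that by (auto simp del: One_nat_def)
  ultimately have "multipermutation_level X sol n"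
    by (rule multipermutation_level_sol)
  moreover have "finite X"
    unfolding X_def by (intro finite_imageI finite_aug_power)
  ultimately show ?thesis
    using nd_inv_solution_sol square_free_sol elementary_abelian_2_group_sol by blast
qed

end
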